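(* Let $\mathcal{H}_d$ be a $d$-dimensional complex Hilbert space, let $\mathbb{X}=\{|x\rangle\}$ and $\mathbb{Z}=\{|z\rangle\}$ be two measurement bases (orthonormal bases) of $\mathcal{H}_d$, and let $C$ be a coherence measure, with $C^{\mathbb{X}}$ and $C^{\mathbb{Z}}$ denoting it relative to the bases $\mathbb{X}$ and $\mathbb{Z}$ respectively. Suppose the two bases are incompatible, i.e. $c_{\min}=\min_{|x\rangle\in\mathbb{X},\,|z\rangle\in\mathbb{Z}}|\langle x|z\rangle|^2>0$. Then for every state $\rho$ on $\mathcal{H}_d$ that is not maximally mixed (i.e. $\rho\neq I/d$), $$C^{\mathbb{X}}(\rho)+C^{\mathbb{Z}}(\rho)>0.$$
   Context: A state on $\mathcal{H}_d$ is a density operator (positive semidefinite, trace one). Given an orthonormal basis $\mathbb{J}=\{|1\rangle,\dots,|d\rangle\}$ of $\mathcal{H}_d$, a state $\sigma$ is called incoherent with respect to $\mathbb{J}$ if $\sigma=\sum_i p_i|i\rangle\langle i|$ with $p_i\in[0,1]$, $\sum_i p_i=1$; otherwise it is called coherent with respect to $\mathbb{J}$. Incoherent operations are physical operations that map incoherent states only to incoherent states. A coherence measure $C^{\mathbb{J}}$ (relative to $\mathbb{J}$) is a function from states to non-negative real numbers such that: (1) $C^{\mathbb{J}}(\rho)=0$ if $\rho$ is incoherent with respect to $\mathbb{J}$ and $C^{\mathbb{J}}(\rho)>0$ if $\rho$ is coherent with respect to $\mathbb{J}$; (2) $C^{\mathbb{J}}$ does not increase under incoherent operations; (3) $C^{\mathbb{J}}$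 is convex. *)

theory Defs
  imports "HOL-Analysis.Analysis"
begin

text \<open>
  The Hilbert space of dimension \<open>d\<close> is \<open>complex ^ 'n\<close> with \<open>d = CARD('n)\<close>; operators are
  square matrices. A measurement basis is an unordered set of vectors.
\<close>

text \<open>Conjugate-linear in the first argument (the library's \<open>\<bullet>\<close> on this type is the real part).\<close>

definition cinner :: "complex ^ 'n \<Rightarrow> complex ^ 'n \<Rightarrow> complex" where
  "cinner u v = (\<Sum>i\<in>UNIV. cnj (u $ i) * v $ i)"

definition ketbra :: "complex ^ 'n \<Rightarrow> complex ^ 'n \<Rightarrow> complex ^ 'n ^ 'n" where
  "ketbra u v = (\<chi> i j. u $ i * cnj (v $ j))"

definition orthonormal_basis :: "(complex ^ 'n) set \<Rightarrow> bool" where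
  "orthonormal_basis J \<longleftrightarrow>
     vec.independent J \<and> vec.span J = UNIV \<and>
     (\<forall>u\<in>J. \<forall>v\<in>J. cinner u v = (if u = v then 1 else 0))"

text \<open>Over the complex numbers, a real quadratic form already forces \<open>A\<close> to be Hermitian.\<close>

definition pos_semidef :: "complex ^ 'n ^ 'n \<Rightarrow> bool" where
  "pos_semidef A \<longleftrightarrow> (\<forall>v. cinner v (A *v v) \<in> \<real>\<^sub>\<ge>\<^sub>0)"

definition states :: "(complex ^ 'n ^ 'n) set" where
  "states = {\<rho>. pos_semidef \<rho> \<and> trace \<rho> = 1}"

definition incoherent :: "(complex ^ 'n) set \<Rightarrow> complex ^ 'n ^ 'n \<Rightarrow> bool" where
  "incoherent J \<sigma> \<longleftrightarrow>
     (\<exists>p :: complex ^ 'n \<Rightarrow> real.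
        (\<forall>u\<in>J. 0 \<le> p u \<and> p u \<le> 1) \<and> (\<Sum>u\<in>J. p u) = 1 \<and>
        \<sigma> = (\<Sum>u\<in>J. p u *\<^sub>R ketbra u u))"

text \<open>
  A family \<open>A i j\<close> with \<open>i, j < k\<close> is the block matrix \<open>\<Sum>i j. |i><j| \<otimes> A i j\<close>, an operator on the
  tensor product of \<open>k\<close>-dimensional space with \<open>complex ^ 'n\<close>. Applying \<open>\<Lambda>\<close> to every block is the
  map \<open>id \<otimes> \<Lambda>\<close>, so complete positivity says that \<open>id \<otimes> \<Lambda>\<close> is positive for every \<open>k\<close>.
\<close>

definition block_pos_semidef :: "nat \<Rightarrow> (nat \<Rightarrow> nat \<Rightarrow> complex ^ 'n ^ 'n) \<Rightarrow> bool" where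
  "block_pos_semidef k A \<longleftrightarrow>
     (\<forall>v :: nat \<Rightarrow> complex ^ 'n.
        (\<Sum>i<k. \<Sum>j<k. cinner (v i) (A i j *v v j)) \<in> \<real>\<^sub>\<ge>\<^sub>0)"

definition completely_positive :: "(complex ^ 'n ^ 'n \<Rightarrow> complex ^ 'n ^ 'n) \<Rightarrow> bool" where
  "completely_positive \<Lambda> \<longleftrightarrow>
     (\<forall>k A. block_pos_semidef k A \<longrightarrow> block_pos_semidef k (\<lambda>i j. \<Lambda> (A i j)))"

text \<open>
  Physical operations are the linear, completely positive, trace-preserving maps;
  \<open>mat c ** A\<close> is the complex multiple of \<open>A\<close> by \<open>c\<close>.
\<close>

definition quantum_channel :: "(complex ^ 'n ^ 'n \<Rightarrow> complex ^ 'n ^ 'n) \<Rightarrow> bool" where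
  "quantum_channel \<Lambda> \<longleftrightarrow>
     (\<forall>A B. \<Lambda> (A + B) = \<Lambda> A + \<Lambda> B) \<and>
     (\<forall>c A. \<Lambda> (mat c ** A) = mat c ** \<Lambda> A) \<and>
     completely_positive \<Lambda> \<and>
     (\<forall>A. trace (\<Lambda> A) = trace A)"

definition incoherent_operation ::
  "(complex ^ 'n) set \<Rightarrow> (complex ^ 'n ^ 'n \<Rightarrow> complex ^ 'n ^ 'n) \<Rightarrow> bool" where
  "incoherent_operation J \<Lambda> \<longleftrightarrow>
     quantum_channel \<Lambda> \<and> (\<forall>\<sigma>. incoherent J \<sigma> \<longrightarrow> incoherent J (\<Lambda> \<sigma>))"

definition coherence_measure_wrt ::
  "(complex ^ 'n) set \<Rightarrow> (complex ^ 'n ^ 'n \<Rightarrow> real) \<Rightarrow> bool" where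
  "coherence_measure_wrt J CJ \<longleftrightarrow>
     (\<forall>\<rho>\<in>states. 0 \<le> CJ \<rho>) \<and>
     (\<forall>\<rho>\<in>states. incoherent J \<rho> \<longrightarrow> CJ \<rho> = 0) \<and>
     (\<forall>\<rho>\<in>states. \<not> incoherent J \<rho> \<longrightarrow> 0 < CJ \<rho>) \<and>
     (\<forall>\<Lambda>. incoherent_operation J \<Lambda> \<longrightarrow> (\<forall>\<rho>\<in>states. CJ (\<Lambda> \<rho>) \<le> CJ \<rho>)) \<and>
     convex_on states CJ"

text \<open>A coherence measure assigns to every orthonormal basis \<open>J\<close> a measure \<open>C J\<close> relative to it.\<close>

definition coherence_measure ::
  "((complex ^ 'n) set \<Rightarrow> complex ^ 'n ^ 'n \<Rightarrow> real) \<Rightarrow> bool" where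
  "coherence_measure C \<longleftrightarrow> (\<forall>J. orthonormal_basis J \<longrightarrow> coherence_measure_wrt J (C J))"

definition c_min :: "(complex ^ 'n) set \<Rightarrow> (complex ^ 'n) set \<Rightarrow> real" where
  "c_min X Z = Min {(cmod (cinner x z))\<^sup>2 | x z. x \<in> X \<and> z \<in> Z}"

end

theory Submission
  imports Defs
begin

text \<open>
  If both terms vanished, \<open>\<rho>\<close> would be diagonal in both bases, with eigenvalues \<open>p x\<close> and \<open>q z\<close>.
  Evaluating \<open>\<langle>x|\<rho>|z\<rangle>\<close> in both ways gives \<open>p x \<langle>x|z\<rangle> = q z \<langle>x|z\<rangle>\<close>. As no overlap is zero, all
  eigenvalues coincide, so \<open>\<rho>\<close> is a multiple of the identity.
\<close>

lemma cinner_sum_right: "cinner u (\<Sum>v\<in>A. f v) = (\<Sum>v\<in>A. cinner u (f v))"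
  unfolding cinner_def by (simp add: sum_distrib_left sum.swap[of _ A])

lemma cinner_scale_right: "cinner u (c *s v) = c * cinner u v"
  unfolding cinner_def by (simp add: sum_distrib_left mult_ac)

text \<open>Each rank-one term sends \<open>w\<close> to its component along \<open>u\<close>.
  Finiteness of \<open>J\<close> is not assumed: over an infinite set both sums default to
  0.\<close>

lemma diagonal_mult_vector:
  "(\<Sum>u\<in>J. p u *\<^sub>R ketbra u u) *v w = (\<Sum>u\<in>J. (of_real (p u) * cinner u w) *s u)"
proof (induction J rule: infinite_finite_induct)
  case (insert u J)
  have "(p u *\<^sub>R ketbra u u) *v w = (of_real (p u) * cinner u w) *s u"
    by (simp add: vec_eq_iff ketbra_def cinner_def matrix_vector_mult_def scaleR_conv_of_real[where 'a = complex]
        sum_distrib_left sum_distrib_right mult_ac)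
  with insert show ?case
    by (simp add: matrix_vector_mult_add_rdistrib)
qed auto

text \<open>Linear independence bounds the size of \<open>J\<close> by the dimension. Finiteness
  lets sums over \<open>J\<close> collapse to one term and makes \<open>Min\<close> in
  \<open>c_min\<close> a genuine minimum.\<close>

lemma orthonormal_basis_finite: "orthonormal_basis J \<Longrightarrow> finite J"
  unfolding orthonormal_basis_def using vec.independent_bound_general by blast

lemma orthonormal_diagonal_eigenvector:
  assumes "orthonormal_basis J" and "u \<in> J"
  shows "(\<Sum>u\<in>J. p u *\<^sub>R ketbra u u) *v u = of_real (p u) *s u"
proof -
  have "(\<Sum>v\<in>J. (of_real (p v) * cinner v u) *s v) = (\<Sum>v\<in>J. if v = u then of_real (p u) *s u else 0)"
    using assms by (intro sum.cong) (auto simp: orthonormal_basis_def)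
  then show ?thesis
    using assms by (simp add: diagonal_mult_vector orthonormal_basis_finite)
qed

text \<open>The bra version of the eigenvector equation: orthogonality removes every term except
  that of \<open>u\<close>, for arbitrary \<open>w\<close>, so no adjoint has to be formed.\<close>

lemma orthonormal_diagonal_cinner:
  assumes "orthonormal_basis J" and "u \<in> J"
  shows "cinner u ((\<Sum>u\<in>J. p u *\<^sub>R ketbra u u) *v w) = of_real (p u) * cinner u w"
proof -
  have "(\<Sum>v\<in>J. (of_real (p v) * cinner v w) * cinner u v) =
      (\<Sum>v\<in>J. if v = u then of_real (p u) * cinner u w else 0)"
    using assms by (intro sum.cong) (auto simp: orthonormal_basis_def)
  then show ?thesis
    using assms
    by (simp add: diagonal_mult_vector cinner_sum_right cinner_scale_right orthonormal_basis_finite)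
qed

lemma c_min_pos_imp_cinner_nonzero:
  assumes "finite X" and "finite Z" and "c_min X Z > 0" and "x \<in> X" and "z \<in> Z"
  shows "cinner x z \<noteq> 0"
proof -
  have "finite {(cmod (cinner x z))\<^sup>2 | x z. x \<in> X \<and> z \<in> Z}"
    using assms(1,2) by (intro finite_image_set2) auto
  then have "c_min X Z \<le> (cmod (cinner x z))\<^sup>2"
    unfolding c_min_def using assms(4,5) by (intro Min_le) auto
  then show ?thesis
    using assms(3) by auto
qed

lemma mat_mult_vector: "mat c *v v = c *s (v :: 'a::comm_semiring_1 ^ 'n)"
  by (simp add: vec_eq_iff matrix_vector_mult_def mat_def if_distrib[of "\<lambda>a. a * b" for b] cong: if_cong)

text \<open>Multiplication by \<open>A\<close> and by \<open>mat c\<close> are linear maps that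
  agree on a spanning set.\<close>

lemma eq_mat_if_eigenbasis:
  fixes A :: "'a::field ^ 'n ^ 'n"
  assumes "vec.span J = UNIV" and "\<And>u. u \<in> J \<Longrightarrow> A *v u = c *s u"
  shows "A = mat c"
proof -
  have "A *v v = mat c *v v" for v
    using assms
    by (intro vec.linear_eq_on[of "(*v) A" "(*v) (mat c)" v J])
       (auto simp: mat_mult_vector)
  then show ?thesis
    by (simp add: matrix_eq)
qed

lemma incoherent_both_imp_maximally_mixed:
  fixes X Z :: "(complex ^ 'n) set"
  assumes X: "orthonormal_basis X" and Z: "orthonormal_basis Z"
    and overlap: "c_min X Z > 0"
    and incX: "incoherent X \<rho>" and incZ: "incoherent Z \<rho>"
    and tr: "trace \<rho> = 1"
  shows "\<rho> = mat (1 / of_nat CARD('n))"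
proof -
  obtain p where p: "\<rho> = (\<Sum>u\<in>X. p u *\<^sub>R ketbra u u)"
    using incX unfolding incoherent_def by blast
  obtain q where q: "\<rho> = (\<Sum>u\<in>Z. q u *\<^sub>R ketbra u u)" and "(\<Sum>u\<in>Z. q u) = 1"
    using incZ unfolding incoherent_def by blast
  \<comment> \<open>The weights \<open>q\<close> sum to 1, whereas a sum over the empty set is
    0.\<close>
  then obtain z where z: "z \<in> Z"
    by fastforce
  \<comment> \<open>One fixed \<open>z\<close> suffices: every \<open>p x\<close> is compared with
    the same number \<open>q z\<close>, after cancelling the nonzero overlap.\<close>
  have "p x = q z" if x: "x \<in> X" for x
  proof -
    have "of_real (p x) * cinner x z = cinner x (\<rho> *v z)"
      unfolding p using orthonormal_diagonal_cinner[OF X x] by simp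
    also have "\<dots> = of_real (q z) * cinner x z"
      unfolding q orthonormal_diagonal_eigenvector[OF Z z] by (rule cinner_scale_right)
    finally show ?thesis
      using c_min_pos_imp_cinner_nonzero[OF _ _ overlap x z] X Z
      by (simp add: orthonormal_basis_finite)
  qed
  then have "\<rho> *v x = of_real (q z) *s x" if "x \<in> X" for x
    using orthonormal_diagonal_eigenvector[OF X that, of p] that p by simp
  moreover have "vec.span X = UNIV"
    using X by (simp add: orthonormal_basis_def)
  ultimately have \<rho>: "\<rho> = mat (of_real (q z))"
    by (rule eq_mat_if_eigenbasis[rotated])
  \<comment> \<open>The trace condition determines the common eigenvalue.\<close>
  have "of_nat CARD('n) * complex_of_real (q z) = 1"
    using tr unfolding \<rho> by (simp add: trace_def mat_def)
  then have "complex_of_real (q z) = 1 / of_nat CARD('n)"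
    by (simp add: field_simps)
  with \<rho> show ?thesis
    by simp
qed

theorem theorem1:
  fixes X Z :: "(complex ^ 'n) set"
    and C :: "(complex ^ 'n) set \<Rightarrow> complex ^ 'n ^ 'n \<Rightarrow> real"
    and \<rho> :: "complex ^ 'n ^ 'n"
  assumes "orthonormal_basis X"
    and "orthonormal_basis Z"
    and "coherence_measure C"
    and "c_min X Z > 0"
    and "\<rho> \<in> states"
    and "\<rho> \<noteq> mat (1 / of_nat CARD('n))"
  shows "C X \<rho> + C Z \<rho> > 0"
proof -
  have X: "coherence_measure_wrt X (C X)" and Z: "coherence_measure_wrt Z (C Z)"
    using assms(1-3) by (auto simp: coherence_measure_def)
  have "trace \<rho> = 1"
    using assms(5) by (simp add: states_def)
  then have "\<not> incoherent X \<rho> \<or> \<not> incoherent Z \<rho>"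
    using incoherent_both_imp_maximally_mixed assms by blast
  then have "0 < C X \<rho> \<or> 0 < C Z \<rho>"
    using X Z assms(5) by (auto simp: coherence_measure_wrt_def)
  \<comment> \<open>Nonnegativity keeps the other term from cancelling the strictly positive
    one.\<close>
  moreover have "0 \<le> C X \<rho>" "0 \<le> C Z \<rho>"
    using X Z assms(5) by (auto simp: coherence_measure_wrt_def)
  ultimately show ?thesis
    by linarith
qed

end
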